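(* Let $G_1$ and $G_2$ be two finite simple graphs on $n_1$ and $n_2$ vertices, respectively. For $i=1,2$ let $\Delta_i$ and $\delta_i$ denote the maximum and minimum vertex degree of $G_i$, and let $\overline{m}$ be the number of edges of $\overline{G_1[G_2]}$. Then $$\sqrt{2}\,\overline{m}\,(n_2\delta_1+\delta_2)\leq \overline{SO}(G_1[G_2])\leq \sqrt{2}\,\overline{m}\,(n_2\Delta_1+\Delta_2).$$ Moreover, equality holds (in both inequalities) if $G_1$ and $G_2$ are regular.
   Context: All graphs are finite and simple, with nonempty vertex set. The composition $G_1[G_2]$ of graphs $G_1$ and $G_2$ with disjoint vertex sets and edge sets is the graph with vertex set $V(G_1)\times V(G_2)$ in which $(u_1,u_2)$ is adjacent to $(v_1,v_2)$ whenever ($u_1$ is adjacent to $v_1$ in $G_1$) or ($u_1=v_1$ and $u_2$ is adjacent to $v_2$ in $G_2$). $d_G(u)$ denotes the degree of $u$ in $G$, and $\overline{G}$ is the complement of $G$. The Sombor coindex of $G$ is $$\overline{SO}(G)=\sum_{uv\in E(\overline{G})}\sqrt{d_G(u)^2+d_G(v)^2},$$ the sum being over unordered pairs of distinct non-adjacent vertices of $G$, with degrees taken in $G$. *)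

theory Defs
  imports Complex_Main
begin

record 'a ugraph =
  verts :: "'a set"
  edges :: "'a set set"

definition all_edges :: "'a set \<Rightarrow> 'a set set" where
  "all_edges V = {e. e \<subseteq> V \<and> card e = 2}"

definition fin_simple_graph :: "'a ugraph \<Rightarrow> bool" where
  "fin_simple_graph G \<longleftrightarrow> finite (verts G) \<and> verts G \<noteq> {} \<and> edges G \<subseteq> all_edges (verts G)"

definition adjacent :: "'a ugraph \<Rightarrow> 'a \<Rightarrow> 'a \<Rightarrow> bool" where
  "adjacent G u v \<longleftrightarrow> {u, v} \<in> edges G"

definition degree :: "'a ugraph \<Rightarrow> 'a \<Rightarrow> nat" where
  "degree G u = card {v \<in> verts G. adjacent G u v}"

definition max_degree :: "'a ugraph \<Rightarrow> nat" where
  "max_degree G = Max (degree G ` verts G)"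

definition min_degree :: "'a ugraph \<Rightarrow> nat" where
  "min_degree G = Min (degree G ` verts G)"

definition regular :: "'a ugraph \<Rightarrow> bool" where
  "regular G \<longleftrightarrow> (\<exists>r. \<forall>u\<in>verts G. degree G u = r)"

definition complement :: "'a ugraph \<Rightarrow> 'a ugraph" where
  "complement G = \<lparr>verts = verts G, edges = all_edges (verts G) - edges G\<rparr>"

definition composition :: "'a ugraph \<Rightarrow> 'b ugraph \<Rightarrow> ('a \<times> 'b) ugraph" where
  "composition G1 G2 =
     \<lparr>verts = verts G1 \<times> verts G2,
      edges = {{(u1, u2), (v1, v2)} | u1 u2 v1 v2.
                 (u1, u2) \<in> verts G1 \<times> verts G2 \<and> (v1, v2) \<in> verts G1 \<times> verts G2 \<and>
                 (adjacent G1 u1 v1 \<or> u1 = v1 \<and> adjacent G2 u2 v2)}\<rparr>"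

text \<open>
  An edge is a two-element set of vertices, so the inner sum over \<open>u \<in> e\<close> is
  \<open>d(u)\<^sup>2 + d(v)\<^sup>2\<close> for \<open>e = {u, v}\<close>, and each unordered pair is counted once.
  The degrees are those in \<open>G\<close>, not in its complement.
\<close>
definition sombor_coindex :: "'a ugraph \<Rightarrow> real" where
  "sombor_coindex G =
     (\<Sum>e\<in>edges (complement G). sqrt (\<Sum>u\<in>e. (real (degree G u))\<^sup>2))"

lemma sombor_term:
  assumes "u \<noteq> v"
  shows "sqrt (\<Sum>w\<in>{u, v}. (real (degree G w))\<^sup>2)
         = sqrt ((real (degree G u))\<^sup>2 + (real (degree G v))\<^sup>2)"
  using assms by simp

lemma fin_simple_graph_composition:
  assumes "fin_simple_graph G1" "fin_simple_graph G2"
  shows "fin_simple_graph (composition G1 G2)"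
proof -
  have "\<not> adjacent G1 a a" for a
    using assms(1) by (auto simp: fin_simple_graph_def all_edges_def adjacent_def)
  moreover have "\<not> adjacent G2 b b" for b
    using assms(2) by (auto simp: fin_simple_graph_def all_edges_def adjacent_def)
  ultimately show ?thesis
    using assms
    by (auto simp: fin_simple_graph_def all_edges_def composition_def card_2_iff) blast+
qed

lemma adjacent_composition_iff:
  assumes "u1 \<in> verts G1" "v1 \<in> verts G1" "u2 \<in> verts G2" "v2 \<in> verts G2"
  shows "adjacent (composition G1 G2) (u1, u2) (v1, v2) \<longleftrightarrow>
           adjacent G1 u1 v1 \<or> u1 = v1 \<and> adjacent G2 u2 v2"
  using assms
  by (auto simp: adjacent_def composition_def doubleton_eq_iff insert_commute)

end

theory Submission imports Defs begin

text \<open>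
  Every vertex \<open>(u, v)\<close> of the composition has degree \<open>n\<^sub>2 d\<^sub>1(u) + d\<^sub>2(v)\<close>: its neighbours are
  all the vertices lying over a neighbour of \<open>u\<close>, together with the neighbours of \<open>v\<close> in its own copy
  of the second graph. So all degrees of the composition lie between \<open>n\<^sub>2 \<delta>\<^sub>1 + \<delta>\<^sub>2\<close> and
  \<open>n\<^sub>2 \<Delta>\<^sub>1 + \<Delta>\<^sub>2\<close>. In any graph whose degrees lie in an interval \<open>[a, b]\<close>, each of the terms of the
  Sombor coindex lies in \<open>[\<surd>2 a, \<surd>2 b]\<close>, and there is one term for each edge of the complement; this
  gives both inequalities. If both factors are regular, the two bounds coincide, and the coindex
  is squeezed between them.
\<close>

lemma not_adjacent_self:
  assumes "fin_simple_graph G"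
  shows "\<not> adjacent G u u"
  using assms by (auto simp: fin_simple_graph_def all_edges_def adjacent_def)

lemma degree_composition:
  assumes G1: "fin_simple_graph G1" and G2: "fin_simple_graph G2"
    and u: "u \<in> verts G1" and v: "v \<in> verts G2"
  shows "degree (composition G1 G2) (u, v) = card (verts G2) * degree G1 u + degree G2 v"
proof -
  let ?N1 = "{x \<in> verts G1. adjacent G1 u x}"
  let ?N2 = "{y \<in> verts G2. adjacent G2 v y}"
  have verts: "verts (composition G1 G2) = verts G1 \<times> verts G2"
    by (simp add: composition_def)
  have nbrs: "{w \<in> verts (composition G1 G2). adjacent (composition G1 G2) (u, v) w}
                = ?N1 \<times> verts G2 \<union> {u} \<times> ?N2"
    using u v by (auto simp: verts adjacent_composition_iff)
  have fin: "finite (verts G1)" "finite (verts G2)"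
    using G1 G2 by (simp_all add: fin_simple_graph_def)
  (* G1 has no loops, so u is not its own neighbour and the first part misses the copy over u. *)
  have "(?N1 \<times> verts G2) \<inter> ({u} \<times> ?N2) = {}"
    using not_adjacent_self[OF G1] by auto
  then show ?thesis
    unfolding degree_def nbrs using fin
    by (simp add: card_Un_disjoint card_cartesian_product)
qed

lemma degree_bounds:
  assumes "fin_simple_graph G" and "u \<in> verts G"
  shows min_degree_le_degree: "min_degree G \<le> degree G u"
    and degree_le_max_degree: "degree G u \<le> max_degree G"
  using assms by (auto simp: fin_simple_graph_def min_degree_def max_degree_def)

lemma regular_min_degree_eq_max_degree:
  assumes "fin_simple_graph G" and "regular G"
  shows "min_degree G = max_degree G"
proof -
  obtain r where "\<forall>u\<in>verts G. degree G u = r"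
    using assms(2) by (auto simp: regular_def)
  then have "degree G ` verts G = {r}"
    using assms(1) by (auto simp: fin_simple_graph_def)
  then show ?thesis
    by (simp add: min_degree_def max_degree_def)
qed

lemma complement_edgeE:
  assumes "e \<in> edges (complement G)"
  obtains u v where "e = {u, v}" "u \<noteq> v" "u \<in> verts G" "v \<in> verts G"
  using assms by (auto simp: complement_def all_edges_def card_2_iff)

text \<open>
  Both terms under each root are at least \<open>a\<^sup>2\<close>, and \<open>\<surd>(a\<^sup>2 + a\<^sup>2) = \<surd>2 a\<close>.
\<close>
lemma sombor_coindex_ge:
  assumes deg: "\<And>u. u \<in> verts G \<Longrightarrow> a \<le> degree G u"
  shows "sqrt 2 * real (card (edges (complement G))) * real a \<le> sombor_coindex G"
proof -
  have "sqrt 2 * real a \<le> sqrt (\<Sum>u\<in>e. (real (degree G u))\<^sup>2)"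
    if edge: "e \<in> edges (complement G)" for e
  proof -
    obtain u v where e: "e = {u, v}" "u \<noteq> v" "u \<in> verts G" "v \<in> verts G"
      using edge by (rule complement_edgeE)
    have "sqrt 2 * real a = sqrt ((real a)\<^sup>2 + (real a)\<^sup>2)"
      by (simp add: real_sqrt_mult flip: mult_2)
    also have "\<dots> \<le> sqrt ((real (degree G u))\<^sup>2 + (real (degree G v))\<^sup>2)"
      using deg[OF e(3)] deg[OF e(4)]
      by (intro real_sqrt_le_mono add_mono power_mono) auto
    finally show ?thesis
      using e by simp
  qed
  then show ?thesis
    using sum_bounded_below[of "edges (complement G)" "sqrt 2 * real a"]
    by (simp add: sombor_coindex_def mult_ac)
qed

lemma sombor_coindex_le:
  assumes deg: "\<And>u. u \<in> verts G \<Longrightarrow> degree G u \<le> b"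
  shows "sombor_coindex G \<le> sqrt 2 * real (card (edges (complement G))) * real b"
proof -
  have "sqrt (\<Sum>u\<in>e. (real (degree G u))\<^sup>2) \<le> sqrt 2 * real b"
    if edge: "e \<in> edges (complement G)" for e
  proof -
    obtain u v where e: "e = {u, v}" "u \<noteq> v" "u \<in> verts G" "v \<in> verts G"
      using edge by (rule complement_edgeE)
    have "sqrt ((real (degree G u))\<^sup>2 + (real (degree G v))\<^sup>2) \<le> sqrt ((real b)\<^sup>2 + (real b)\<^sup>2)"
      using deg[OF e(3)] deg[OF e(4)]
      by (intro real_sqrt_le_mono add_mono power_mono) auto
    also have "\<dots> = sqrt 2 * real b"
      by (simp add: real_sqrt_mult flip: mult_2)
    finally show ?thesis
      using e by simp
  qed
  then show ?thesis
    using sum_bounded_above[of "edges (complement G)" _ "sqrt 2 * real b"]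
    by (simp add: sombor_coindex_def mult_ac)
qed

theorem theorem5p7:
  fixes G1 :: "'a ugraph" and G2 :: "'b ugraph"
    and n1 n2 \<Delta>1 \<Delta>2 \<delta>1 \<delta>2 m :: nat
  assumes "fin_simple_graph G1" and "fin_simple_graph G2"
    and "n1 = card (verts G1)" and "n2 = card (verts G2)"
    and "\<Delta>1 = max_degree G1" and "\<Delta>2 = max_degree G2"
    and "\<delta>1 = min_degree G1" and "\<delta>2 = min_degree G2"
    and "m = card (edges (complement (composition G1 G2)))"
  shows "sqrt 2 * real m * (real n2 * real \<delta>1 + real \<delta>2) \<le> sombor_coindex (composition G1 G2)
       \<and> sombor_coindex (composition G1 G2) \<le> sqrt 2 * real m * (real n2 * real \<Delta>1 + real \<Delta>2)
       \<and> (regular G1 \<and> regular G2 \<longrightarrow>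
            sqrt 2 * real m * (real n2 * real \<delta>1 + real \<delta>2) = sombor_coindex (composition G1 G2)
          \<and> sombor_coindex (composition G1 G2) = sqrt 2 * real m * (real n2 * real \<Delta>1 + real \<Delta>2))"
proof -
  let ?G = "composition G1 G2"
  have deg: "n2 * \<delta>1 + \<delta>2 \<le> degree ?G w \<and> degree ?G w \<le> n2 * \<Delta>1 + \<Delta>2"
    if w: "w \<in> verts ?G" for w
  proof -
    obtain u v where uv: "w = (u, v)" "u \<in> verts G1" "v \<in> verts G2"
      using w by (auto simp: composition_def)
    have "degree ?G w = n2 * degree G1 u + degree G2 v"
      using degree_composition[OF assms(1,2) uv(2,3)] uv(1) assms(4) by simp
    then show ?thesis
      using degree_bounds[OF assms(1) uv(2)] degree_bounds[OF assms(2) uv(3)] assms(5-8)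
      by (simp add: add_mono)
  qed
  have lower: "sqrt 2 * real m * (real n2 * real \<delta>1 + real \<delta>2) \<le> sombor_coindex ?G"
    using sombor_coindex_ge[of ?G "n2 * \<delta>1 + \<delta>2"] deg assms(9) by simp
  have upper: "sombor_coindex ?G \<le> sqrt 2 * real m * (real n2 * real \<Delta>1 + real \<Delta>2)"
    using sombor_coindex_le[of ?G "n2 * \<Delta>1 + \<Delta>2"] deg assms(9) by simp
  have "\<delta>1 = \<Delta>1 \<and> \<delta>2 = \<Delta>2" if "regular G1 \<and> regular G2"
    using that assms(1,2,5-8) by (simp add: regular_min_degree_eq_max_degree)
  with lower upper show ?thesis
    by (auto intro: antisym)
qed

end
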